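(* Let $k \geq 2$, let $e$ be an edge of the $3$-regular tree $T_3$, and let $g \in \operatorname{Aut}(T_3)$ be a good inversion (with respect to $e$). Then the $(P_k)$-closure $\langle g \rangle^{(P_k)}$ contains no edge inversion of finite order.
   Context: For a tree $T$ with vertex set $VT$ and graph distance $d$, put $B(v,n)=\{w\in VT \mid d(v,w)\le n\}$ and $S(v,n)=\{w\in VT\mid d(v,w)=n\}$. For an edge $e$ with endpoints $v,w$, let $T_v$ and $T_w$ be the two components of $T-e$ containing $v$ and $w$ respectively, and define $S(e,n)=(S(v,n)\cap T_v)\cup(S(w,n)\cap T_w)$. In $T_3$ the set $S(e,n)$ has $2^{n+1}$ elements. An edge inversion is an automorphism of the tree that swaps the two endpoints of some edge. For $G\le\operatorname{Aut}(T)$, the $(P_k)$-closure of $G$ is $G^{(P_k)}=\{h\in\operatorname{Aut}(T)\mid \forall v\in VT\ \exists g\in G:\ h|_{B(v,k)}=g|_{B(v,k)}\}$. Good inversion: fix an edge $e$ of $T_3$. An automorphism $g$ of $T_3$ is a good inversion (with respect to $e$) if it maps $e$ to itself and, for every $n\ge 0$, acts on $S(e,n)$ as a single cycle of length $2^{n+1}$ (in particular it swaps the endpoints of $e$). *)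

theory Defs
  imports "HOL-Algebra.Generated_Groups" "HOL-Combinatorics.Orbits"
begin

text \<open>Undirected simple graphs, given by a vertex set and a set of two-element edges.
  Walks are nonempty vertex lists; a walk with \<open>Suc n\<close> vertices has length \<open>n\<close>.\<close>

definition simple_graph :: "'v set \<Rightarrow> 'v set set \<Rightarrow> bool" where
  "simple_graph V E \<longleftrightarrow> (\<forall>e\<in>E. e \<subseteq> V \<and> card e = 2)"

definition walk :: "'v set \<Rightarrow> 'v set set \<Rightarrow> 'v \<Rightarrow> 'v list \<Rightarrow> 'v \<Rightarrow> bool" where
  "walk V E u xs v \<longleftrightarrow> xs \<noteq> [] \<and> set xs \<subseteq> V \<and> hd xs = u \<and> last xs = v \<and>
     successively (\<lambda>x y. {x, y} \<in> E) xs"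

definition connected_graph :: "'v set \<Rightarrow> 'v set set \<Rightarrow> bool" where
  "connected_graph V E \<longleftrightarrow> V \<noteq> {} \<and> (\<forall>u\<in>V. \<forall>v\<in>V. \<exists>xs. walk V E u xs v)"

definition graph_cycle :: "'v set \<Rightarrow> 'v set set \<Rightarrow> 'v list \<Rightarrow> bool" where
  "graph_cycle V E xs \<longleftrightarrow> length xs \<ge> 3 \<and> distinct xs \<and> set xs \<subseteq> V \<and>
     successively (\<lambda>x y. {x, y} \<in> E) xs \<and> {last xs, hd xs} \<in> E"

definition tree :: "'v set \<Rightarrow> 'v set set \<Rightarrow> bool" where
  "tree V E \<longleftrightarrow> simple_graph V E \<and> connected_graph V E \<and> (\<nexists>xs. graph_cycle V E xs)"

definition regular_tree :: "nat \<Rightarrow> 'v set \<Rightarrow> 'v set set \<Rightarrow> bool" where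
  "regular_tree d V E \<longleftrightarrow> tree V E \<and>
     (\<forall>v\<in>V. finite {e \<in> E. v \<in> e} \<and> card {e \<in> E. v \<in> e} = d)"

definition gdist :: "'v set \<Rightarrow> 'v set set \<Rightarrow> 'v \<Rightarrow> 'v \<Rightarrow> nat" where
  "gdist V E u v = (LEAST n. \<exists>xs. walk V E u xs v \<and> length xs = Suc n)"

definition gball :: "'v set \<Rightarrow> 'v set set \<Rightarrow> 'v \<Rightarrow> nat \<Rightarrow> 'v set" where
  "gball V E v n = {w \<in> V. gdist V E v w \<le> n}"

definition gsphere :: "'v set \<Rightarrow> 'v set set \<Rightarrow> 'v \<Rightarrow> nat \<Rightarrow> 'v set" where
  "gsphere V E v n = {w \<in> V. gdist V E v w = n}"

definition component_of :: "'v set \<Rightarrow> 'v set set \<Rightarrow> 'v \<Rightarrow> 'v set" where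
  "component_of V E v = {w \<in> V. \<exists>xs. walk V E v xs w}"

definition edge_sphere :: "'v set \<Rightarrow> 'v set set \<Rightarrow> 'v set \<Rightarrow> nat \<Rightarrow> 'v set" where
  "edge_sphere V E e n = (\<Union>v\<in>e. gsphere V E v n \<inter> component_of V (E - {e}) v)"

text \<open>Automorphisms are permutations of \<open>V\<close> that are the identity outside \<open>V\<close>, so that
  equality of functions is equality of automorphisms.\<close>

definition graph_aut :: "'v set \<Rightarrow> 'v set set \<Rightarrow> ('v \<Rightarrow> 'v) \<Rightarrow> bool" where
  "graph_aut V E f \<longleftrightarrow> f permutes V \<and> (\<forall>u\<in>V. \<forall>v\<in>V. {f u, f v} \<in> E \<longleftrightarrow> {u, v} \<in> E)"

definition aut_group :: "'v set \<Rightarrow> 'v set set \<Rightarrow> ('v \<Rightarrow> 'v) monoid" where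
  "aut_group V E = \<lparr>carrier = {f. graph_aut V E f}, monoid.mult = (\<circ>), one = id\<rparr>"

lemma group_aut_group: "group (aut_group V E)"
proof (rule groupI)
  fix f assume "f \<in> carrier (aut_group V E)"
  then have f: "f permutes V" and e: "\<And>u v. u \<in> V \<Longrightarrow> v \<in> V \<Longrightarrow> {f u, f v} \<in> E \<longleftrightarrow> {u, v} \<in> E"
    by (auto simp: aut_group_def graph_aut_def)
  have "graph_aut V E (inv_into UNIV f)"
    unfolding graph_aut_def
  proof (intro conjI ballI)
    show p: "inv_into UNIV f permutes V" by (rule permutes_inv[OF f])
    fix u v assume "u \<in> V" "v \<in> V"
    then show "{inv_into UNIV f u, inv_into UNIV f v} \<in> E \<longleftrightarrow> {u, v} \<in> E"
      using e[of "inv_into UNIV f u" "inv_into UNIV f v"] p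
      by (simp add: permutes_in_image permutes_inverses[OF f])
  qed
  then show "\<exists>y\<in>carrier (aut_group V E). y \<otimes>\<^bsub>aut_group V E\<^esub> f = \<one>\<^bsub>aut_group V E\<^esub>"
    using permutes_inv_o(2)[OF f] by (auto simp: aut_group_def)
qed (auto simp: aut_group_def graph_aut_def permutes_compose permutes_id permutes_in_image o_assoc)

definition Pk_closure :: "'v set \<Rightarrow> 'v set set \<Rightarrow> nat \<Rightarrow> ('v \<Rightarrow> 'v) set \<Rightarrow> ('v \<Rightarrow> 'v) set" where
  "Pk_closure V E k G = {h \<in> carrier (aut_group V E).
     \<forall>v\<in>V. \<exists>g\<in>G. \<forall>x\<in>gball V E v k. h x = g x}"

definition edge_inversion :: "'v set \<Rightarrow> 'v set set \<Rightarrow> ('v \<Rightarrow> 'v) \<Rightarrow> bool" where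
  "edge_inversion V E h \<longleftrightarrow> h \<in> carrier (aut_group V E) \<and>
     (\<exists>v w. {v, w} \<in> E \<and> h v = w \<and> h w = v)"

definition good_inversion :: "'v set \<Rightarrow> 'v set set \<Rightarrow> 'v set \<Rightarrow> ('v \<Rightarrow> 'v) \<Rightarrow> bool" where
  "good_inversion V E e g \<longleftrightarrow> g \<in> carrier (aut_group V E) \<and> g ` e = e \<and>
     (\<forall>n. cyclic_on g (edge_sphere V E e n) \<and> card (edge_sphere V E e n) = 2 ^ (n + 1))"

end

theory Submission
  imports Defs
begin

text \<open>
  Fix a ray \<open>z 0, z 1, ...\<close> with \<open>z n\<close> in \<open>S(e, n)\<close>; then \<open>S(e, n)\<close> consists of the vertices
  \<open>g^j (z n)\<close> with \<open>j\<close> modulo \<open>2^(n+1)\<close>. Let \<open>h\<close> be in the closure and let \<open>d x\<close> be an exponent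
  with \<open>h = g^(d x)\<close> on \<open>B(x, 2)\<close>. Comparing \<open>h\<close> on the grandchildren of \<open>x\<close> shows that \<open>d\<close> agrees
  modulo \<open>2^(n+3)\<close> at \<open>x\<close> in \<open>S(e, n)\<close> and at its children, so the sum \<open>D n\<close> of \<open>d\<close> over \<open>S(e, n)\<close>
  satisfies \<open>D (n+1) = 2 * D n\<close> modulo \<open>2^(n+3)\<close>. If \<open>h\<close> inverts an edge, that edge is \<open>e\<close>, both
  exponents at its ends are odd and they agree modulo 4; hence \<open>D n\<close> is an odd multiple of
  \<open>2^(n+1)\<close> for all \<open>n\<close>. By induction \<open>h\<close> is transitive on \<open>S(e, n)\<close>, so its power
  \<open>h^(2^(n+1))\<close> acts on the children of \<open>z n\<close> as \<open>g^(D n)\<close>, which exchanges them. Thus \<open>h\<close> is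
  transitive on every \<open>S(e, n)\<close> and has infinite order.
\<close>

section \<open>Binary odometers\<close>

lemma sum_lessThan_add:
  fixes f :: "nat \<Rightarrow> 'a::comm_monoid_add"
  shows "sum f {..<m + n} = sum f {..<m} + (\<Sum>l<n. f (l + m))"
  by (induction n) (simp_all add: ac_simps)

text \<open>Models the powers of \<open>g\<close> along a ray: \<open>P i\<close> is the
  \<open>i\<close>-th power, and \<open>z n\<close> lies on a cycle of length
  \<open>2 ^ Suc n\<close>.\<close>

locale odometer =
  fixes P :: "int \<Rightarrow> 'a \<Rightarrow> 'a" and z :: "nat \<Rightarrow> 'a"
  assumes P_zero: "P 0 x = x"
    and P_add: "P (i + j) x = P i (P j x)"
    and P_fix_iff: "P i (z n) = z n \<longleftrightarrow> 2 ^ Suc n dvd i"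
begin

lemma P_eq_iff: "P i (z n) = P j (z n) \<longleftrightarrow> 2 ^ Suc n dvd i - j"
proof -
  have "P i (z n) = P j (z n) \<longleftrightarrow> P (- j) (P i (z n)) = P (- j) (P j (z n))"
    using P_add[of j "- j"] by (metis P_zero add.right_inverse)
  also have "\<dots> \<longleftrightarrow> P (i - j) (z n) = z n"
    by (simp add: P_add[symmetric] P_zero)
  finally show ?thesis by (simp add: P_fix_iff)
qed

end

text \<open>\<open>d x\<close> is the exponent of a power that agrees with \<open>h\<close> at
  \<open>x\<close> and up to two levels further out. \<open>d_base\<close> does across the root edge
  what \<open>d_child\<close> does between consecutive levels.\<close>

locale locally_odometer = odometer P z for P :: "int \<Rightarrow> 'a \<Rightarrow> 'a" and z +
  fixes h :: "'a \<Rightarrow> 'a" and d :: "'a \<Rightarrow> int"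
  assumes inj_h: "inj h"
    and h_near: "n \<le> m \<Longrightarrow> m \<le> n + 2 \<Longrightarrow>
      h (P j (z m)) = P (d (P j (z n))) (P j (z m))"
    and d_base: "4 dvd d (P 1 (z 0)) - d (z 0)"
    and d_odd: "odd (d (z 0))"
begin

definition total_shift :: "nat \<Rightarrow> int" where
  "total_shift n = (\<Sum>j<2 ^ Suc n. d (P (int j) (z n)))"

text \<open>The exponent accumulated along the first \<open>m\<close> points of the
  \<open>h\<close>-orbit; it turns \<open>h ^^ m\<close> at \<open>z n\<close> into a single
  power.\<close>

definition orbit_shift :: "nat \<Rightarrow> nat \<Rightarrow> int" where
  "orbit_shift n m = (\<Sum>l<m. d ((h ^^ l) (z n)))"

text \<open>Both exponents describe \<open>h\<close> at the common descendant
  \<open>P j (z (n + 2))\<close>, which is fixed exactly by the multiples of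
  \<open>2 ^ (n + 3)\<close>.\<close>

lemma d_child: "2 ^ (n + 3) dvd d (P j (z (Suc n))) - d (P j (z n))"
proof -
  have "P (d (P j (z (Suc n)))) (P j (z (n + 2))) = P (d (P j (z n))) (P j (z (n + 2)))"
    using h_near[of n "n + 2" j] h_near[of "Suc n" "n + 2" j] by simp
  then show ?thesis
    by (simp add: P_add[symmetric] P_eq_iff eval_nat_numeral)
qed

lemma total_shift_Suc: "2 ^ (n + 3) dvd total_shift (Suc n) - 2 * total_shift n"
proof -
  let ?N = "2 ^ Suc n :: nat"
  have "(\<Sum>j<2 * ?N. d (P (int j) (z n))) =
      (\<Sum>j<?N. d (P (int j) (z n))) + (\<Sum>j<?N. d (P (int (j + ?N)) (z n)))"
    unfolding mult_2 by (rule sum_lessThan_add)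
  \<comment> \<open>Moving \<open>j\<close> by \<open>?N\<close> does not change
    \<open>P j (z n)\<close>, so the halves agree: each point of level \<open>n\<close> is counted
    once per child.\<close>
  also have "(\<Sum>j<?N. d (P (int (j + ?N)) (z n))) = total_shift n"
    unfolding total_shift_def
    by (rule sum.cong[OF refl], rule arg_cong[of _ _ d]) (simp add: P_eq_iff)
  finally have "total_shift (Suc n) - 2 * total_shift n =
      (\<Sum>j<2 ^ Suc (Suc n). d (P (int j) (z (Suc n))) - d (P (int j) (z n)))"
    by (simp add: total_shift_def sum_subtractf)
  then show ?thesis
    using d_child by (simp only: dvd_sum)
qed

text \<open>The error \<open>2 ^ (n + 3) * a\<close> changes the cofactor of
  \<open>2 ^ Suc (Suc n)\<close> by the even number \<open>2 * a\<close>, so oddness survives.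
  Agreement modulo 4 gives the start.\<close>

lemma total_shift_odd_multiple: "\<exists>c. odd c \<and> total_shift n = 2 ^ Suc n * c"
proof (induction n)
  case 0
  obtain a where a: "d (P 1 (z 0)) = d (z 0) + 4 * a"
    using d_base by (metis dvd_def add.commute diff_add_cancel)
  have "total_shift 0 = 2 * (d (z 0) + 2 * a)"
    by (simp add: total_shift_def eval_nat_numeral P_zero a)
  then show ?case
    using d_odd by (intro exI[of _ "d (z 0) + 2 * a"]) simp
next
  case (Suc n)
  then obtain c where c: "odd c" "total_shift n = 2 ^ Suc n * c" by blast
  obtain a where "total_shift (Suc n) - 2 * total_shift n = 2 ^ (n + 3) * a"
    using total_shift_Suc by (auto elim: dvdE)
  then have "total_shift (Suc n) = 2 ^ Suc (Suc n) * (c + 2 * a)"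
    by (simp add: c algebra_simps eval_nat_numeral)
  then show ?case
    using c by (intro exI[of _ "c + 2 * a"]) simp
qed

text \<open>At each step the local power valid at a point of level \<open>n\<close> also moves its
  child, so one exponent serves both levels.\<close>

lemma funpow_h: "(h ^^ m) (z n) = P (orbit_shift n m) (z n)"
  and funpow_h_child: "(h ^^ m) (z (Suc n)) = P (orbit_shift n m) (z (Suc n))"
proof (induction m)
  case 0
  { case 1 show ?case by (simp add: orbit_shift_def P_zero) }
  { case 2 show ?case by (simp add: orbit_shift_def P_zero) }
next
  case (Suc m)
  have s: "orbit_shift n (Suc m) = d (P (orbit_shift n m) (z n)) + orbit_shift n m"
    using Suc(1) by (simp add: orbit_shift_def)
  { case 1 show ?case using Suc(1) h_near[of n n] by (simp add: s P_add) }
  { case 2 show ?case using Suc(2) h_near[of n "Suc n"] by (simp add: s P_add) }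
qed

text \<open>Once \<open>N\<close> is a period of \<open>z n\<close>, every round of \<open>N\<close>
  steps collects the same exponents.\<close>

lemma orbit_shift_mult:
  assumes "(h ^^ N) (z n) = z n"
  shows "orbit_shift n (N * q) = int q * orbit_shift n N"
proof (induction q)
  case 0
  show ?case by (simp add: orbit_shift_def)
next
  case (Suc q)
  have per: "(h ^^ (N * q)) (z n) = z n"
    by (induction q) (simp_all add: funpow_add assms)
  have "orbit_shift n (N * Suc q) =
      orbit_shift n (N * q) + (\<Sum>l<N. d ((h ^^ (l + N * q)) (z n)))"
    unfolding orbit_shift_def mult_Suc_right add.commute[of N] by (rule sum_lessThan_add)
  then show ?case
    using Suc by (simp add: funpow_add per orbit_shift_def algebra_simps)
qed

text \<open>By induction the \<open>h\<close>-orbit of \<open>z n\<close> fills its level, so one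
  round shifts by \<open>total_shift n\<close>, an odd multiple of \<open>2 ^ Suc n\<close>. Hence
  only an even number of rounds can fix the child.\<close>

lemma period_dvd: "(h ^^ m) (z n) = z n \<Longrightarrow> 2 ^ Suc n dvd m"
proof (induction n arbitrary: m)
  case 0
  have "even (orbit_shift 0 m)"
    using 0 by (simp add: funpow_h P_fix_iff)
  moreover have "odd (d (P j (z 0)))" for j
  proof (cases "even j")
    case True
    then have "P j (z 0) = P 0 (z 0)" by (simp add: P_eq_iff)
    then show ?thesis using d_odd by (simp add: P_zero)
  next
    case False
    then have "P j (z 0) = P 1 (z 0)" by (simp add: P_eq_iff)
    moreover have "even (d (P 1 (z 0)) - d (z 0))"
      using d_base by (rule dvd_trans[rotated]) simp
    ultimately show ?thesis using d_odd by simp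
  qed
  then have "odd (d ((h ^^ l) (z 0)))" for l
    by (simp add: funpow_h)
  then have "even (orbit_shift 0 m) \<longleftrightarrow> even m"
    unfolding orbit_shift_def by (induction m) auto
  ultimately show ?case by simp
next
  case (Suc n)
  let ?N = "2 ^ Suc n :: nat"
  \<comment> \<open>The first \<open>?N\<close> points of the \<open>h\<close>-orbit and of the
    \<open>P\<close>-orbit form the same set, so \<open>d\<close> has the same sum along
    both.\<close>
  have shift: "orbit_shift n ?N = total_shift n"
  proof -
    have inj_g: "inj_on (\<lambda>j. P (int j) (z n)) {..<?N}"
    proof (rule inj_onI)
      fix i j assume ij: "i \<in> {..<?N}" "j \<in> {..<?N}" "P (int i) (z n) = P (int j) (z n)"
      then have "int i mod int ?N = int j mod int ?N"
        by (simp add: P_eq_iff mod_eq_dvd_iff)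
      then have "i mod ?N = j mod ?N"
        by (simp only: of_nat_mod[symmetric] of_nat_eq_iff)
      then show "i = j" using ij by (simp only: lessThan_iff mod_less)
    qed
    have inj_orbit: "inj_on (\<lambda>l. (h ^^ l) (z n)) {..<?N}"
    proof (rule linorder_inj_onI)
      fix i j assume ij: "i < j" "i \<in> {..<?N}" "j \<in> {..<?N}"
      show "(h ^^ i) (z n) \<noteq> (h ^^ j) (z n)"
      proof
        assume "(h ^^ i) (z n) = (h ^^ j) (z n)"
        then have "(h ^^ i) (z n) = (h ^^ i) ((h ^^ (j - i)) (z n))"
          using ij by (metis comp_apply funpow_add le_add_diff_inverse less_imp_le)
        then have "(h ^^ (j - i)) (z n) = z n"
          using inj_fn[OF inj_h, of i] by (metis injD)
        from Suc.IH[OF this] show False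
          using ij by (auto dest: dvd_imp_le)
      qed
    qed linarith
    have "(\<lambda>l. (h ^^ l) (z n)) ` {..<?N} \<subseteq> (\<lambda>j. P (int j) (z n)) ` {..<?N}"
    proof safe
      fix l
      let ?j = "nat (orbit_shift n l mod int ?N)"
      have "(h ^^ l) (z n) = P (int ?j) (z n)"
        by (simp add: funpow_h P_eq_iff mod_eq_dvd_iff[symmetric])
      moreover have "?j < ?N" by (simp add: nat_less_iff)
      ultimately show "(h ^^ l) (z n) \<in> (\<lambda>j. P (int j) (z n)) ` {..<?N}" by blast
    qed
    then have "(\<lambda>l. (h ^^ l) (z n)) ` {..<?N} = (\<lambda>j. P (int j) (z n)) ` {..<?N}"
      by (rule card_subset_eq[rotated]) (simp_all only: card_image inj_g inj_orbit finite_imageI finite_lessThan)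
    then show ?thesis
      unfolding orbit_shift_def total_shift_def
      using sum.reindex[OF inj_orbit, of d] sum.reindex[OF inj_g, of d] by (simp add: o_def)
  qed
  obtain c where c: "odd c" "total_shift n = 2 ^ Suc n * c"
    using total_shift_odd_multiple by blast
  have N: "(h ^^ ?N) (z n) = z n"
    by (simp only: funpow_h shift P_fix_iff c) simp
  have m: "2 ^ Suc (Suc n) dvd orbit_shift n m"
    using Suc.prems by (simp add: funpow_h_child P_fix_iff)
  then have "(h ^^ m) (z n) = z n"
    unfolding funpow_h P_fix_iff by (rule dvd_trans[rotated]) simp
  from Suc.IH[OF this] obtain q where q: "m = ?N * q" by (auto elim: dvdE)
  \<comment> \<open>After \<open>q\<close> rounds the exponent is \<open>q * 2 ^ Suc n * c\<close>
    with \<open>c\<close> odd; one more factor 2 must come from \<open>q\<close>.\<close>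
  have "2 ^ Suc n * 2 dvd 2 ^ Suc n * (int q * c)"
    using m unfolding q orbit_shift_mult[OF N] shift c by (simp add: ac_simps)
  then have "even (int q * c)"
    by (subst (asm) dvd_mult_cancel_left) simp
  then show ?case
    using c q by auto
qed

lemma funpow_neq_id:
  assumes "m > 0"
  shows "h ^^ m \<noteq> id"
proof
  assume "h ^^ m = id"
  \<comment> \<open>Such an \<open>m\<close> is a period at every level; the cycle at level
    \<open>m\<close> is already too long.\<close>
  then have "2 ^ Suc m \<le> m"
    using period_dvd[of m m] assms by (auto dest: dvd_imp_le)
  moreover have "m < 2 ^ Suc m"
    using less_exp[of "Suc m"] by simp
  ultimately show False by simp
qed

end

section \<open>Walks and distances\<close>

lemma gdist_le:
  assumes "walk V E u xs v" "length xs = Suc n"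
  shows "gdist V E u v \<le> n"
  unfolding gdist_def using assms by (intro Least_le) blast

lemma walk_gdist:
  assumes "walk V E u ys v"
  obtains xs where "walk V E u xs v" "length xs = Suc (gdist V E u v)"
proof -
  have "\<exists>n xs. walk V E u xs v \<and> length xs = Suc n"
    using assms by (intro exI[of _ "length ys - 1"] exI[of _ ys]) (auto simp: walk_def)
  then have "\<exists>xs. walk V E u xs v \<and> length xs = Suc (gdist V E u v)"
    unfolding gdist_def by (rule LeastI_ex)
  then show thesis using that by blast
qed

lemma walk_append:
  assumes "walk V E u xs v" "{v, w} \<in> E" "w \<in> V"
  shows "walk V E u (xs @ [w]) w"
  using assms by (auto simp: walk_def successively_append_iff)

text \<open>Here \<open>k \<ge> 2\<close> enters: the exponent chosen at \<open>x\<close> also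
  governs vertices two steps away.\<close>

lemma gball_adjacent:
  assumes "simple_graph V E" "{x, y} \<in> E" "{y, w} \<in> E" "k \<ge> 2"
  shows "x \<in> gball V E x k" "y \<in> gball V E x k" "w \<in> gball V E x k"
proof -
  have V: "x \<in> V" "y \<in> V" "w \<in> V"
    using assms by (auto simp: simple_graph_def)
  have 1: "walk V E x [x] x" "walk V E x [x, y] y" "walk V E x [x, y, w] w"
    using V assms by (auto simp: walk_def)
  show "x \<in> gball V E x k" "y \<in> gball V E x k" "w \<in> gball V E x k"
    using gdist_le[OF 1(1), of 0] gdist_le[OF 1(2), of 1] gdist_le[OF 1(3), of 2] V assms(4)
    by (auto simp: gball_def)
qed

lemma component_of_adjacent:
  assumes "w \<in> component_of V E v" "{w, x} \<in> E" "x \<in> V"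
  shows "x \<in> component_of V E v"
  using assms walk_append by (fastforce simp: component_of_def)

section \<open>Levels of a good inversion\<close>

locale good_inversion_graph =
  fixes V :: "'v set" and E :: "'v set set" and e :: "'v set" and g :: "'v \<Rightarrow> 'v"
  assumes simple: "simple_graph V E"
    and e_edge: "e \<in> E"
    and good: "good_inversion V E e g"
begin

abbreviation level :: "nat \<Rightarrow> 'v set" where
  "level \<equiv> edge_sphere V E e"

definition g_pow :: "int \<Rightarrow> 'v \<Rightarrow> 'v" where
  "g_pow i = g [^]\<^bsub>aut_group V E\<^esub> i"

lemma g_aut: "g \<in> carrier (aut_group V E)"
  using good by (simp add: good_inversion_def)

lemma cyclic_level: "cyclic_on g (level n)"
  and card_level: "card (level n) = 2 ^ Suc n"
  using good by (simp_all add: good_inversion_def)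

lemma funpow_eq_nat_pow: "f [^]\<^bsub>aut_group V E\<^esub> (n::nat) = f ^^ n"
  by (induction n) (simp_all add: aut_group_def nat_pow_def funpow_Suc_right del: funpow.simps(2))

lemma g_pow_nat: "g_pow (int n) = g ^^ n"
  by (simp add: g_pow_def int_pow_int funpow_eq_nat_pow)

lemma g_pow_zero: "g_pow 0 x = x"
  using g_pow_nat[of 0] by simp

lemma g_pow_add: "g_pow (i + j) x = g_pow i (g_pow j x)"
  unfolding g_pow_def group.int_pow_mult[OF group_aut_group g_aut]
  by (simp add: aut_group_def)

lemma g_pow_edge:
  assumes "{x, y} \<in> E"
  shows "{g_pow i x, g_pow i y} \<in> E"
proof -
  have "graph_aut V E (g_pow i)"
    using group.int_pow_closed[OF group_aut_group g_aut] by (simp add: g_pow_def aut_group_def)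
  then show ?thesis
    using assms simple by (auto simp: graph_aut_def simple_graph_def)
qed

lemma generate_g: "generate (aut_group V E) {g} = range g_pow"
  using group.generate_pow[OF group_aut_group g_aut] by (auto simp: g_pow_def)

text \<open>The cycle of \<open>g\<close> through \<open>x\<close> is the whole level, so its length
  is \<open>2 ^ Suc n\<close>. The second part excludes an earlier return.\<close>

lemma g_pow_mod:
  assumes "x \<in> level n"
  shows "g_pow i x = (g ^^ nat (i mod 2 ^ Suc n)) x"
    and "m < 2 ^ Suc n \<Longrightarrow> (g ^^ m) x = x \<Longrightarrow> m = 0"
proof -
  let ?p = "funpow_dist1 g x x"
  have orb: "orbit g x = level n"
    using orbit_cyclic_eq3[OF cyclic_level assms] .
  then have x: "x \<in> orbit g x" using assms by simp
  have p: "?p = 2 ^ Suc n"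
    using orbit_conv_funpow_dist1[OF x] card_image[OF inj_on_funpow_dist1[OF x]] card_level[of n]
    unfolding orb by simp
  show "m < 2 ^ Suc n \<Longrightarrow> (g ^^ m) x = x \<Longrightarrow> m = 0"
    using funpow_dist1_least[of m g x x] unfolding p by blast
  have N: "g_pow (2 ^ Suc n) x = x"
    using funpow_dist1_prop[OF x] g_pow_nat[of ?p] unfolding p by simp
  have nat: "g_pow (2 ^ Suc n * int c) x = x" for c
    by (induction c) (simp_all add: g_pow_zero g_pow_add N[simplified] distrib_left)
  have "g_pow (2 ^ Suc n * c) x = x" for c
  proof (cases c rule: int_cases2)
    case (nonneg c')
    then show ?thesis using nat by simp
  next
    case (nonpos c')
    have "x = g_pow (2 ^ Suc n * c + 2 ^ Suc n * int c') x"
      by (simp add: nonpos g_pow_zero)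
    then show ?thesis
      by (simp only: g_pow_add nat)
  qed
  then have "g_pow (i mod 2 ^ Suc n + 2 ^ Suc n * (i div 2 ^ Suc n)) x = g_pow (i mod 2 ^ Suc n) x"
    by (simp only: g_pow_add)
  then have "g_pow i x = g_pow (i mod 2 ^ Suc n) x"
    by (simp only: mod_mult_div_eq)
  also have "\<dots> = (g ^^ nat (i mod 2 ^ Suc n)) x"
    using g_pow_nat[of "nat (i mod 2 ^ Suc n)"] by simp
  finally show "g_pow i x = (g ^^ nat (i mod 2 ^ Suc n)) x" .
qed

lemma g_pow_fix_iff:
  assumes "x \<in> level n"
  shows "g_pow i x = x \<longleftrightarrow> 2 ^ Suc n dvd i"
proof
  assume "g_pow i x = x"
  then have "nat (i mod 2 ^ Suc n) = 0"
    using g_pow_mod(1)[OF assms, of i]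
    by (intro g_pow_mod(2)[OF assms]) (simp_all add: nat_less_iff)
  moreover have "0 \<le> i mod 2 ^ Suc n"
    by (rule pos_mod_sign) simp
  ultimately have "i mod 2 ^ Suc n = 0"
    by linarith
  then show "2 ^ Suc n dvd i"
    by (simp only: dvd_eq_mod_eq_0)
next
  assume "2 ^ Suc n dvd i"
  then show "g_pow i x = x"
    using g_pow_mod(1)[OF assms, of i] by (simp add: dvd_eq_mod_eq_0)
qed

lemma g_pow_level: "x \<in> level n \<Longrightarrow> g_pow i x \<in> level n"
  using g_pow_mod(1) cyclic_on_funpow_in[OF cyclic_level] by simp

lemma level_transitive:
  assumes "x \<in> level n" "y \<in> level n"
  shows "\<exists>i. y = g_pow i x"
proof -
  have "y \<in> orbit g x"
    using orbit_cyclic_eq3[OF cyclic_level assms(1)] assms(2) by simp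
  then show ?thesis
    by (auto simp: orbit_altdef g_pow_nat[symmetric])
qed

text \<open>Levels are \<open>g\<close>-orbits, so two that meet coincide, and their sizes tell them
  apart.\<close>

lemma level_disjoint:
  assumes "x \<in> level m" "x \<in> level n"
  shows "m = n"
proof -
  have "level m = level n"
    using orbit_cyclic_eq3[OF cyclic_level assms(1)] orbit_cyclic_eq3[OF cyclic_level assms(2)] by simp
  then have "(2::nat) ^ Suc m = 2 ^ Suc n"
    using card_level by metis
  then show ?thesis by simp
qed

lemma level_zero: "level 0 = e"
proof -
  have "v \<in> level 0" if "v \<in> e" for v
  proof -
    have "v \<in> V" using that e_edge simple by (auto simp: simple_graph_def)
    then have "walk V F v [v] v" for F by (simp add: walk_def)
    then have "v \<in> gsphere V E v 0 \<inter> component_of V (E - {e}) v"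
      using gdist_le[of V E v "[v]" v 0] \<open>v \<in> V\<close> by (auto simp: gsphere_def component_of_def)
    then show ?thesis using that by (auto simp: edge_sphere_def)
  qed
  then show ?thesis
    using card_subset_eq[OF finite_cyclic_on[OF cyclic_level[of 0]], of e] card_level[of 0]
      e_edge simple by (auto simp: simple_graph_def)
qed

text \<open>Take the penultimate vertex of a geodesic from the end \<open>v\<close> of
  \<open>e\<close>. As \<open>w\<close> is not in \<open>e\<close>, the last edge differs from
  \<open>e\<close>, so this vertex stays on the side of \<open>v\<close>.\<close>

lemma level_parent:
  assumes "w \<in> level (Suc n)"
  shows "\<exists>x\<in>level n. {x, w} \<in> E"
proof -
  obtain v where v: "v \<in> e" "w \<in> V" "gdist V E v w = Suc n" "w \<in> component_of V (E - {e}) v"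
    using assms by (auto simp: edge_sphere_def gsphere_def)
  then obtain ws where "walk V (E - {e}) v ws w" by (auto simp: component_of_def)
  then have "walk V E v ws w"
    unfolding walk_def by (auto elim: successively_mono)
  then obtain xs where xs: "walk V E v xs w" "length xs = Suc (Suc n)"
    using v(3) by (metis walk_gdist)
  then obtain ys where ys: "xs = ys @ [w]" "length ys = Suc n"
    by (cases xs rule: rev_cases) (auto simp: walk_def)
  define x where "x = last ys"
  have "ys \<noteq> []" using ys by auto
  then have x: "walk V E v ys x" "{x, w} \<in> E" "x \<in> V"
    using xs(1) unfolding ys(1) x_def by (auto simp: walk_def successively_append_iff)
  have "gdist V E v x \<le> n"
    using gdist_le[OF x(1) ys(2)] .
  moreover have "Suc n \<le> Suc (gdist V E v x)"
    using walk_gdist[OF x(1)] gdist_le[OF walk_append[OF _ x(2) v(2)]] v(3)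
    by (metis length_append_singleton)
  ultimately have "gdist V E v x = n" by simp
  moreover have "w \<notin> e"
    using assms level_zero level_disjoint by fastforce
  then have "{w, x} \<in> E - {e}"
    using x(2) by (auto simp: insert_commute)
  then have "x \<in> component_of V (E - {e}) v"
    using component_of_adjacent v(4) x(3) by metis
  ultimately have "x \<in> level n"
    using v(1) x(3) by (auto simp: edge_sphere_def gsphere_def)
  then show ?thesis using x(2) by blast
qed

text \<open>Some vertex of level \<open>Suc n\<close> has a parent, and a power of \<open>g\<close>
  carries that parent to \<open>x\<close>.\<close>

lemma level_child:
  assumes "x \<in> level n"
  shows "\<exists>w\<in>level (Suc n). {x, w} \<in> E"
proof -
  obtain w where w: "w \<in> level (Suc n)"
    using cyclic_level[of "Suc n"] by (auto simp: cyclic_on_def)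
  obtain y where y: "y \<in> level n" "{y, w} \<in> E"
    using level_parent[OF w] by blast
  obtain i where "x = g_pow i y"
    using level_transitive[OF y(1) assms] by blast
  then show ?thesis
    using g_pow_edge[OF y(2), of i] g_pow_level[OF w, of i] by blast
qed

text \<open>Along a walk starting in \<open>e\<close>, a vertex off \<open>e\<close> inherits the
  side of its predecessor, while an end of \<open>e\<close> starts its own side.\<close>

lemma level_cover:
  assumes "connected_graph V E" "u \<in> V"
  shows "\<exists>n. u \<in> level n"
proof -
  obtain v where v: "v \<in> e" "v \<in> V"
    using e_edge simple by (fastforce simp: simple_graph_def card_2_iff)
  obtain xs where "walk V E v xs u"
    using assms v by (auto simp: connected_graph_def)
  then have "\<exists>w\<in>e. u \<in> component_of V (E - {e}) w"
  proof (induction xs arbitrary: u rule: rev_induct)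
    case Nil
    then show ?case by (simp add: walk_def)
  next
    case (snoc y ys)
    have u: "u = y" "u \<in> V" using snoc.prems by (auto simp: walk_def)
    have self: ?case if "u \<in> e"
      using that u(2) by (intro bexI[of _ u]) (auto simp: component_of_def walk_def intro!: exI[of _ "[u]"])
    show ?case
    proof (cases "ys = []")
      case True
      then show ?thesis using snoc.prems v self by (auto simp: walk_def)
    next
      case False
      then have *: "walk V E v ys (last ys)" "{last ys, u} \<in> E"
        using snoc.prems u by (auto simp: walk_def successively_append_iff)
      obtain w where "w \<in> e" "last ys \<in> component_of V (E - {e}) w"
        using snoc.IH[OF *(1)] by blast
      then show ?thesis
        using self component_of_adjacent[of "last ys" V "E - {e}" w u] *(2) u(2) by blast
    qed
  qed
  then obtain w where "w \<in> e" "u \<in> component_of V (E - {e}) w" by blast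
  then have "u \<in> level (gdist V E w u)"
    using assms(2) by (auto simp: edge_sphere_def gsphere_def)
  then show ?thesis ..
qed

lemma exists_ray: "\<exists>z. (\<forall>n. z n \<in> level n) \<and> (\<forall>n. {z n, z (Suc n)} \<in> E)"
proof -
  obtain z0 where "z0 \<in> level 0"
    using cyclic_level[of 0] by (auto simp: cyclic_on_def)
  then have "\<exists>z. \<forall>n. z n \<in> level n \<and> {z n, z (Suc n)} \<in> E"
    using dependent_nat_choice[of "\<lambda>n x. x \<in> level n" "\<lambda>_ x y. {x, y} \<in> E"] level_child by blast
  then show ?thesis by blast
qed

lemma inverted_edge_level_zero:
  assumes "\<nexists>xs. graph_cycle V E xs" "{v, w} \<in> E" "v \<in> level n"
    and "g_pow i v = w" "g_pow i w = v"
  shows "n = 0"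
  \<comment> \<open>Otherwise \<open>g_pow i\<close> fixes the level below, so \<open>v\<close> and \<open>w\<close> have a common neighbour there.\<close>
proof (rule ccontr)
  assume "n \<noteq> 0"
  then obtain m where n: "n = Suc m" by (cases n) auto
  obtain x where x: "x \<in> level m" "{x, v} \<in> E"
    using level_parent assms(3) n by blast
  have "g_pow (i + i) v = v" using assms by (simp only: g_pow_add)
  then have "2 ^ Suc n dvd i + i" using g_pow_fix_iff[OF assms(3)] by simp
  then have "2 * 2 ^ Suc m dvd 2 * i" by (simp add: n)
  then have "2 ^ Suc m dvd i" by (subst (asm) dvd_mult_cancel_left) simp
  then have "g_pow i x = x" using g_pow_fix_iff[OF x(1)] by simp
  then have "{x, w} \<in> E" using g_pow_edge[OF x(2), of i] assms(4) by simp
  moreover have "x \<noteq> y" if "{x, y} \<in> E" for x y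
    using that simple by (auto simp: simple_graph_def)
  ultimately have "graph_cycle V E [x, v, w]"
    using x(2) assms(2) simple
    by (auto simp: graph_cycle_def simple_graph_def insert_commute)
  then show False using assms(1) by blast
qed

end

section \<open>Edge inversions in the closure\<close>

theorem corollary3p3:
  fixes V :: "'v set" and E :: "'v set set" and e :: "'v set"
    and g :: "'v \<Rightarrow> 'v" and k :: nat
  assumes "regular_tree 3 V E"
    and "k \<ge> 2"
    and "e \<in> E"
    and "good_inversion V E e g"
  shows "\<not> (\<exists>h \<in> Pk_closure V E k (generate (aut_group V E) {g}).
            edge_inversion V E h \<and>
            (\<exists>n::nat. n > 0 \<and> h [^]\<^bsub>aut_group V E\<^esub> n = \<one>\<^bsub>aut_group V E\<^esub>))"
proof
  assume "\<exists>h \<in> Pk_closure V E k (generate (aut_group V E) {g}).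
            edge_inversion V E h \<and>
            (\<exists>n::nat. n > 0 \<and> h [^]\<^bsub>aut_group V E\<^esub> n = \<one>\<^bsub>aut_group V E\<^esub>)"
  then obtain h n where h: "h \<in> Pk_closure V E k (generate (aut_group V E) {g})"
    and inversion: "edge_inversion V E h"
    and n: "n > 0" "h [^]\<^bsub>aut_group V E\<^esub> (n::nat) = \<one>\<^bsub>aut_group V E\<^esub>"
    by blast
  have tree: "simple_graph V E" "connected_graph V E" "\<nexists>xs. graph_cycle V E xs"
    using assms(1) by (auto simp: regular_tree_def tree_def)
  interpret good_inversion_graph V E e g
    using tree(1) assms by unfold_locales
  have "\<forall>x\<in>V. \<exists>i. \<forall>y\<in>gball V E x k. h y = g_pow i y"
    using h by (auto simp: Pk_closure_def generate_g)
  then obtain d where d: "\<And>x y. x \<in> V \<Longrightarrow> y \<in> gball V E x k \<Longrightarrow> h y = g_pow (d x) y"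
    by metis
  have d_near: "h x = g_pow (d x) x" "h y = g_pow (d x) y" "h w = g_pow (d x) w"
    if "{x, y} \<in> E" "{y, w} \<in> E" for x y w
    using that d[of x] gball_adjacent[OF tree(1) that assms(2)] tree(1)
    by (auto simp: simple_graph_def)

  obtain z where z: "\<And>n. z n \<in> level n" "\<And>n. {z n, z (Suc n)} \<in> E"
    using exists_ray by blast
  interpret odometer g_pow z
    using g_pow_zero g_pow_add g_pow_fix_iff[OF z(1)] by unfold_locales auto

  have z_edge: "{g_pow j (z n), g_pow j (z (Suc n))} \<in> E" for j n
    using g_pow_edge z(2) by blast
  have near: "h (g_pow j (z m)) = g_pow (d (g_pow j (z n))) (g_pow j (z m))"
    if "n \<le> m" "m \<le> n + 2" for j n m
  proof -
    have "m = n \<or> m = Suc n \<or> m = Suc (Suc n)" using that by linarith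
    then show ?thesis using d_near[OF z_edge[of j n] z_edge[of j "Suc n"]] by auto
  qed
  have "g_pow 1 (z 0) \<noteq> z 0"
    by (simp add: P_fix_iff)
  then have e: "e = {z 0, g_pow 1 (z 0)}"
    using z(1)[of 0] g_pow_level[OF z(1), of 1 0] level_zero e_edge tree(1)
    by (auto simp: simple_graph_def card_2_iff)
  \<comment> \<open>\<open>g_pow 1 (z 1)\<close> is two steps from \<open>z 0\<close>, across
    \<open>e\<close>, so the exponents at both ends of \<open>e\<close> describe \<open>h\<close>
    there. Lying in level 1, it yields the modulus 4.\<close>
  then have "h (g_pow 1 (z 1)) = g_pow (d (z 0)) (g_pow 1 (z 1))"
    using d_near(3)[of "z 0" "g_pow 1 (z 0)" "g_pow 1 (z 1)"] e_edge z_edge[of 1 0] by simp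
  then have base: "4 dvd d (g_pow 1 (z 0)) - d (z 0)"
    using near[of 0 1 1] by (simp add: P_add[symmetric] P_eq_iff dvd_diff_commute)

  obtain v w where vw: "{v, w} \<in> E" "h v = w" "h w = v"
    using inversion by (auto simp: edge_inversion_def)
  have V: "v \<in> V" "v \<noteq> w" using vw(1) tree(1) by (auto simp: simple_graph_def)
  have wv: "{w, v} \<in> E" using vw(1) by (simp add: insert_commute)
  have swap: "g_pow (d v) v = w" "g_pow (d v) w = v"
    using d_near[OF vw(1) wv] vw by auto
  obtain l where l: "v \<in> level l" using level_cover[OF tree(2) V(1)] by blast
  then have v0: "v \<in> level 0"
    using inverted_edge_level_zero[OF tree(3) vw(1) _ swap] by metis
  \<comment> \<open>An even power of \<open>g\<close> would fix \<open>v\<close>, as level 0 is a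
    cycle of length 2.\<close>
  have "odd (d v)"
    using swap(1) V(2) g_pow_fix_iff[OF v0, of "d v"] by auto
  moreover have "v = z 0 \<or> v = g_pow 1 (z 0)"
    using v0 level_zero e by auto
  moreover have "even (d (g_pow 1 (z 0)) - d (z 0))"
    using base by (rule dvd_trans[rotated]) simp
  ultimately have odd: "odd (d (z 0))" by auto

  have "inj h"
    using h by (auto simp: Pk_closure_def aut_group_def graph_aut_def permutes_inj)
  interpret locally_odometer g_pow z h d
    using \<open>inj h\<close> near base odd by unfold_locales
  show False
    using funpow_neq_id[OF n(1)] n(2) by (simp add: funpow_eq_nat_pow) (simp add: aut_group_def)
qed

end
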